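(* For $q>1$ and $|u|<1/q$, $$\sum_{n \geq 0} u^n q^{n^2} \left[ \sum_{r=0}^{2n-1} \frac{1}{|O^+(r,q)||O^-(2n-r,q)|} + \sum_{r=1}^{2n} \frac{1}{|O^-(r,q)||O^+(2n-r,q)|} \right]$$ is equal to $$\frac{1}{2 (1-uq)} \frac{\prod_{i \geq 1} (1+u/q^{2(i-1)})^2}{\prod_{i \geq 1} (1-u^2/q^{2(i-1)})} - \frac{1}{2} \frac{\prod_{i \geq 1} (1+u/q^{2i-1})^2}{\prod_{i \geq 1} (1-u^2/q^{2(i-1)})}.$$
   Context: Here $q$ is a real number, $u$ is a complex number, and $|O^{\pm}(r,q)|$ denote the following expressions (which for odd prime powers $q$ are orders of finite orthogonal groups): for $m\ge 0$, $|O^{+}(2m+1,q)|=|O^{-}(2m+1,q)|=2q^{m^2}\prod_{i=1}^m(q^{2i}-1)$ (so $|O^{\pm}(1,q)|=2$); for $m\ge 1$, $|O^{\pm}(2m,q)|=\frac{2q^{m^2-m}}{q^m\pm 1}\prod_{i=1}^m (q^{2i}-1)$; and by convention $|O^+(0,q)|=1$ and $1/|O^-(0,q)|=0$. Sums whose upper limit is less than their lower limit are empty (equal to $0$). *)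

theory Defs
  imports "HOL-Analysis.Analysis"
begin

text \<open>
  The expressions for the orders of the finite orthogonal groups, as functions of an
  arbitrary real \<open>q\<close>, where \<open>m = r div 2\<close>. The convention that the reciprocal of the order
  of the minus type group in dimension \<open>0\<close> is \<open>0\<close> is encoded by the value \<open>0\<close>, using
  \<open>1 / 0 = 0\<close>.
\<close>

definition card_O_plus :: "nat \<Rightarrow> real \<Rightarrow> real" where
  "card_O_plus r q =
     (let m = r div 2 in
      if r = 0 then 1
      else if odd r then 2 * q ^ (m\<^sup>2) * (\<Prod>i=1..m. q ^ (2 * i) - 1)
      else 2 * q ^ (m\<^sup>2 - m) / (q ^ m + 1) * (\<Prod>i=1..m. q ^ (2 * i) - 1))"

definition card_O_minus :: "nat \<Rightarrow> real \<Rightarrow> real" where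
  "card_O_minus r q =
     (let m = r div 2 in
      if r = 0 then 0
      else if odd r then 2 * q ^ (m\<^sup>2) * (\<Prod>i=1..m. q ^ (2 * i) - 1)
      else 2 * q ^ (m\<^sup>2 - m) / (q ^ m - 1) * (\<Prod>i=1..m. q ^ (2 * i) - 1))"

end

theory Submission imports Defs begin

text \<open>
  Put \<open>x = 1 / q\<close>, \<open>Q = x\<^sup>2\<close> and let \<open>A(u)\<close> be the sum of
  \<open>x ^ (a - b)\<^sup>2 u ^ (a + b) / ((Q;Q)\<^sub>a (Q;Q)\<^sub>b)\<close> over all \<open>a\<close>, \<open>b\<close>.
  Splitting the sums over \<open>r\<close> by parity, the left-hand side becomes
  \<open>((1 + u q) A(u q) - A(u)) / 2\<close>, since the contributions \<open>q ^ b - q ^ a\<close> of the even part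
  cancel by symmetry. For fixed \<open>a\<close>, Euler's identity evaluates the sum over \<open>b\<close>, and the
  \<open>q\<close>-binomial theorem then evaluates the sum over \<open>a\<close>, giving
  \<open>A(u) = (- u x; Q)\<^sup>2 / (u\<^sup>2; Q)\<close> with infinite \<open>q\<close>-Pochhammer symbols. Both identities
  are instances of the homogeneous \<open>q\<close>-binomial theorem for
  \<open>h(s, t) = \<Sum>n. (\<Prod>j<n. s - t Q ^ j) / (Q;Q)\<^sub>n\<close>, which follows by iterating
  \<open>(1 - s) h(s, t) = (1 - t) h(s Q, t Q)\<close>.
\<close>

section \<open>Finite and infinite q-Pochhammer symbols\<close>

definition qpoch :: "'a::comm_ring_1 \<Rightarrow> 'a \<Rightarrow> nat \<Rightarrow> 'a" where
  "qpoch a Q n = (\<Prod>i<n. 1 - a * Q ^ i)"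

definition qpoch_inf :: "'a::{real_normed_field,banach} \<Rightarrow> 'a \<Rightarrow> 'a" where
  "qpoch_inf a Q = (\<Prod>i. 1 - a * Q ^ i)"

lemma qpoch_0 [simp]: "qpoch a Q 0 = 1"
  by (simp add: qpoch_def)

lemma qpoch_Suc: "qpoch a Q (Suc n) = qpoch a Q n * (1 - a * Q ^ n)"
  by (simp add: qpoch_def)

lemma qpoch_of_real:
  "of_real (qpoch a Q n) = (qpoch (of_real a) (of_real Q) n :: 'a::{real_algebra_1,comm_ring_1})"
  by (simp add: qpoch_def)

lemma mult_power_neq_1:
  fixes a Q :: "'a::real_normed_field"
  assumes "norm Q < 1" "norm a < 1"
  shows "1 - a * Q ^ i \<noteq> 0"
proof
  assume "1 - a * Q ^ i = 0"
  hence "norm (a * Q ^ i) = 1" by simp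
  moreover have "norm Q ^ i \<le> 1" using assms by (intro power_le_one) auto
  hence "norm a * norm Q ^ i \<le> norm a" by (simp add: mult_left_le)
  ultimately show False using assms by (simp add: norm_mult norm_power)
qed

lemma convergent_prod_qpoch:
  fixes a Q :: "'a::{real_normed_field,banach}"
  assumes "norm Q < 1"
  shows "convergent_prod (\<lambda>i. 1 - a * Q ^ i)"
proof (intro abs_convergent_prod_imp_convergent_prod summable_imp_abs_convergent_prod)
  show "summable (\<lambda>i. norm (1 - a * Q ^ i - 1))"
    using assms by (simp add: norm_mult norm_power summable_mult summable_geometric)
qed

lemma qpoch_LIMSEQ:
  fixes a Q :: "'a::{real_normed_field,banach}"
  assumes "norm Q < 1"
  shows "qpoch a Q \<longlonglongrightarrow> qpoch_inf a Q"
proof -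
  have "(\<lambda>n. \<Prod>i<n. 1 - a * Q ^ i) \<longlonglongrightarrow> qpoch_inf a Q"
    using convergent_prod_LIMSEQ[OF convergent_prod_qpoch[OF assms, of a]]
    unfolding LIMSEQ_lessThan_iff_atMost qpoch_inf_def .
  thus ?thesis by (simp add: qpoch_def[abs_def])
qed

lemma qpoch_inf_nonzero:
  fixes a Q :: "'a::{real_normed_field,banach}"
  assumes "norm Q < 1" "norm a < 1"
  shows "qpoch_inf a Q \<noteq> 0"
  unfolding qpoch_inf_def
  using convergent_prod_qpoch[OF assms(1)] mult_power_neq_1[OF assms] by (intro prodinf_nonzero) auto

text \<open>Peeling off the first factor is a functional equation in \<open>a\<close>. It serves to
  evaluate the rows of the double series and, at the end, to compare the products belonging to u q
  and to u.\<close>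

lemma qpoch_inf_Suc:
  fixes a Q :: "'a::{real_normed_field,banach}"
  assumes "norm Q < 1"
  shows "qpoch_inf a Q = (1 - a) * qpoch_inf (a * Q) Q"
proof -
  have *: "qpoch a Q (Suc n) = (1 - a) * qpoch (a * Q) Q n" for n
    by (simp add: qpoch_def prod.lessThan_Suc_shift mult_ac del: prod.lessThan_Suc)
  have "(\<lambda>n. qpoch a Q (Suc n)) \<longlonglongrightarrow> qpoch_inf a Q"
    using qpoch_LIMSEQ[OF assms] by (rule LIMSEQ_Suc)
  moreover have "(\<lambda>n. qpoch a Q (Suc n)) \<longlonglongrightarrow> (1 - a) * qpoch_inf (a * Q) Q"
    unfolding * by (intro tendsto_intros qpoch_LIMSEQ assms)
  ultimately show ?thesis by (rule LIMSEQ_unique)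
qed

text \<open>The finite symbols converge to a nonzero limit, so their reciprocals converge too and
  are therefore bounded. This bound dominates the double series below.\<close>

lemma inverse_qpoch_bounded:
  fixes a Q :: "'a::{real_normed_field,banach}"
  assumes "norm Q < 1" "norm a < 1"
  obtains C where "\<And>n. norm (1 / qpoch a Q n) \<le> C"
proof -
  have "(\<lambda>n. 1 / qpoch a Q n) \<longlonglongrightarrow> 1 / qpoch_inf a Q"
    by (intro tendsto_intros qpoch_LIMSEQ qpoch_inf_nonzero assms)
  hence "Bseq (\<lambda>n. 1 / qpoch a Q n)" by (meson convergentI convergent_imp_Bseq)
  thus ?thesis using that by (auto simp: Bseq_def)
qed

section \<open>The homogeneous q-binomial theorem\<close>

definition qbinom_term :: "'a::field \<Rightarrow> 'a \<Rightarrow> 'a \<Rightarrow> nat \<Rightarrow> 'a" where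
  "qbinom_term Q s t n = (\<Prod>j<n. s - t * Q ^ j) / qpoch Q Q n"

lemma qbinom_term_0 [simp]: "qbinom_term Q s t 0 = 1"
  by (simp add: qbinom_term_def)

lemma qbinom_term_Suc:
  "qbinom_term Q s t (Suc n) = qbinom_term Q s t n * ((s - t * Q ^ n) / (1 - Q ^ Suc n))"
  by (simp add: qbinom_term_def qpoch_Suc)

text \<open>The term of index \<open>n\<close> is homogeneous of degree \<open>n\<close> in (s, t).
  Hence h(s Q^N, t Q^N) can be studied through the terms of h(s, t), weighted by Q^(N n).\<close>

lemma qbinom_term_scale: "qbinom_term Q (s * z) (t * z) n = z ^ n * qbinom_term Q s t n"
proof -
  have "(\<Prod>j<n. s * z - t * z * Q ^ j) = (\<Prod>j<n. z * (s - t * Q ^ j))"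
    by (simp add: algebra_simps)
  thus ?thesis by (simp add: qbinom_term_def prod.distrib)
qed

text \<open>The ratio of consecutive terms tends to \<open>s\<close>, so the ratio test applies with
  any constant strictly between |s| and 1. The size of \<open>t\<close> does not affect this
  limit.\<close>

lemma summable_norm_qbinom_term:
  fixes Q s t :: "'a::{real_normed_field,banach}"
  assumes Q: "norm Q < 1" and s: "norm s < 1"
  shows "summable (\<lambda>n. norm (qbinom_term Q s t n))"
proof -
  obtain c where c: "norm s < c" "c < 1" using s dense by blast
  have "(\<lambda>n. (s - t * Q ^ n) / (1 - Q ^ Suc n)) \<longlonglongrightarrow> (s - t * 0) / (1 - 0)"
    by (intro tendsto_intros LIMSEQ_power_zero LIMSEQ_Suc Q) auto
  hence "(\<lambda>n. norm ((s - t * Q ^ n) / (1 - Q ^ Suc n))) \<longlonglongrightarrow> norm s"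
    using tendsto_norm by fastforce
  hence "\<forall>\<^sub>F n in sequentially. norm ((s - t * Q ^ n) / (1 - Q ^ Suc n)) < c"
    using c(1) by (rule order_tendstoD)
  then obtain N where N: "\<And>n. n \<ge> N \<Longrightarrow> norm ((s - t * Q ^ n) / (1 - Q ^ Suc n)) < c"
    by (auto simp: eventually_sequentially)
  show ?thesis
  proof (rule summable_ratio_test[OF c(2)])
    fix n assume "N \<le> n"
    from less_imp_le[OF N[OF this]]
    have "norm ((s - t * Q ^ n) / (1 - Q ^ Suc n)) * norm (qbinom_term Q s t n)
          \<le> c * norm (qbinom_term Q s t n)"
      by (rule mult_right_mono) simp
    thus "norm (norm (qbinom_term Q s t (Suc n))) \<le> c * norm (norm (qbinom_term Q s t n))"
      unfolding qbinom_term_Suc norm_mult by (simp add: mult.commute)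
  qed
qed

text \<open>Sum the recurrence (1 - Q^(n+1)) c(n+1) = (s - t Q^n) c(n) over all n. By homogeneity
  the series of Q^n c(n) is h(s Q, t Q), so with H = h(s, t) and K = h(s Q, t Q) the result is H - K
  = s H - t K.\<close>

lemma suminf_qbinom_term_step:
  fixes Q s t :: "'a::{real_normed_field,banach}"
  assumes Q: "norm Q < 1" and s: "norm s < 1"
  shows "(1 - s) * suminf (qbinom_term Q s t) = (1 - t) * suminf (qbinom_term Q (s * Q) (t * Q))"
proof -
  let ?c = "qbinom_term Q s t"
  define H K where "H = suminf ?c" and "K = (\<Sum>n. Q ^ n * ?c n)"
  have H: "?c sums H"
    using summable_norm_cancel[OF summable_norm_qbinom_term[OF assms]]
    by (simp add: H_def summable_sums)
  have "norm (s * Q) < 1"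
    using mult_strict_mono'[OF s Q] by (simp add: norm_mult)
  from summable_norm_cancel[OF summable_norm_qbinom_term[OF Q this, of "t * Q"]]
  have K: "(\<lambda>n. Q ^ n * ?c n) sums K"
    by (simp add: K_def summable_sums qbinom_term_scale)
  have nz: "1 - Q ^ Suc n \<noteq> 0" for n
    using mult_power_neq_1[OF Q Q, of n] by simp
  have eq: "?c (Suc n) - Q ^ Suc n * ?c (Suc n) = s * ?c n - t * (Q ^ n * ?c n)" for n
  proof -
    have "?c (Suc n) - Q ^ Suc n * ?c (Suc n) = ?c (Suc n) * (1 - Q ^ Suc n)"
      by (simp add: algebra_simps)
    also have "\<dots> = ?c n * (s - t * Q ^ n)"
      unfolding qbinom_term_Suc using nz[of n] by simp
    finally show ?thesis by (simp add: algebra_simps)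
  qed
  have "(\<lambda>n. ?c n - Q ^ n * ?c n) sums (H - K)"
    by (rule sums_diff[OF H K])
  \<comment> \<open>The term of index 0 is 1 - 1 = 0, so dropping it leaves the sum
    unchanged.\<close>
  hence "(\<lambda>n. ?c (Suc n) - Q ^ Suc n * ?c (Suc n)) sums (H - K)"
    by (subst sums_Suc_iff) simp
  moreover have "(\<lambda>n. s * ?c n - t * (Q ^ n * ?c n)) sums (s * H - t * K)"
    by (intro sums_diff sums_mult H K)
  ultimately have "H - K = s * H - t * K"
    unfolding eq by (rule sums_unique2)
  hence "(1 - s) * H = (1 - t) * K" by (simp add: algebra_simps)
  moreover have "suminf (qbinom_term Q (s * Q) (t * Q)) = K"
    by (simp add: K_def qbinom_term_scale[abs_def])
  ultimately show ?thesis by (simp add: H_def)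
qed

text \<open>Scaling by Q^N fixes the constant term 1 and multiplies every later term by at least one
  factor Q^N. The distance from 1 is thus at most |Q|^N times a constant independent of N.\<close>

lemma suminf_qbinom_term_LIMSEQ:
  fixes Q s t :: "'a::{real_normed_field,banach}"
  assumes Q: "norm Q < 1" and s: "norm s < 1"
  shows "(\<lambda>N. suminf (qbinom_term Q (s * Q ^ N) (t * Q ^ N))) \<longlonglongrightarrow> 1"
proof -
  let ?c = "qbinom_term Q s t"
  note sm = summable_norm_qbinom_term[OF assms, of t]
  define M where "M = (\<Sum>n. norm (?c (Suc n)))"
  have smS: "summable (\<lambda>n. norm (?c (Suc n)))"
    using sm by (subst summable_Suc_iff)
  have bound: "norm (suminf (qbinom_term Q (s * Q ^ N) (t * Q ^ N)) - 1) \<le> norm Q ^ N * M" for N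
  proof -
    let ?d = "\<lambda>n. (Q ^ N) ^ n * ?c n"
    have le: "norm (?d (Suc n)) \<le> norm Q ^ N * norm (?c (Suc n))" for n
    proof -
      have "norm Q ^ N \<le> 1" using Q by (intro power_le_one) auto
      hence "(norm Q ^ N) ^ n \<le> 1" by (simp add: power_le_one)
      hence "(norm Q ^ N) ^ Suc n \<le> norm Q ^ N" by (simp add: mult_left_le)
      from mult_right_mono[OF this, of "norm (?c (Suc n))"] show ?thesis
        by (simp add: norm_mult norm_power)
    qed
    have s1: "summable (\<lambda>n. norm (?d (Suc n)))"
      by (rule summable_comparison_test'[OF summable_mult[OF smS, of "norm Q ^ N"], of 0])
        (use le in simp)
    have "summable (\<lambda>n. ?d (Suc n))" using s1 by (rule summable_norm_cancel)
    hence "summable ?d" by (subst (asm) summable_Suc_iff)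
    from suminf_split_head[OF this] have "suminf ?d - 1 = (\<Sum>n. ?d (Suc n))" by simp
    hence "norm (suminf ?d - 1) \<le> (\<Sum>n. norm (?d (Suc n)))"
      using summable_norm[OF s1] by simp
    also have "\<dots> \<le> (\<Sum>n. norm Q ^ N * norm (?c (Suc n)))"
      by (intro suminf_le s1 summable_mult smS le)
    also have "\<dots> = norm Q ^ N * M"
      unfolding M_def by (rule suminf_mult[OF smS])
    finally show ?thesis by (simp add: qbinom_term_scale[abs_def])
  qed
  have "(\<lambda>N. norm Q ^ N * M) \<longlonglongrightarrow> 0"
    using Q by (intro tendsto_mult_left_zero LIMSEQ_power_zero) auto
  hence "(\<lambda>N. suminf (qbinom_term Q (s * Q ^ N) (t * Q ^ N)) - 1) \<longlonglongrightarrow> 0"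
    by (rule Lim_null_comparison[rotated]) (simp add: bound)
  thus ?thesis by (simp add: LIM_zero_iff)
qed

text \<open>With s = z and t = a z this is the usual sum of (a;Q)_n z^n / (Q;Q)_n. The homogeneous
  form also admits s = 0, which is Euler's identity, without a limit in a.\<close>

theorem qbinomial_theorem:
  fixes Q s t :: "'a::{real_normed_field,banach}"
  assumes Q: "norm Q < 1" and s: "norm s < 1"
  shows "qbinom_term Q s t sums (qpoch_inf t Q / qpoch_inf s Q)"
proof -
  define h where "h = (\<lambda>N. suminf (qbinom_term Q (s * Q ^ N) (t * Q ^ N)))"
  have "qpoch s Q N * h 0 = qpoch t Q N * h N" for N
  proof (induction N)
    case (Suc N)
    have "norm Q ^ N \<le> 1" using Q by (intro power_le_one) auto
    hence "norm (s * Q ^ N) \<le> norm s" by (simp add: norm_mult norm_power mult_left_le)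
    with s have "norm (s * Q ^ N) < 1" by simp
    from suminf_qbinom_term_step[OF Q this, of "t * Q ^ N"]
    have step: "(1 - s * Q ^ N) * h N = (1 - t * Q ^ N) * h (Suc N)"
      by (simp add: h_def mult_ac)
    have "qpoch s Q (Suc N) * h 0 = (1 - s * Q ^ N) * (qpoch s Q N * h 0)"
      by (simp add: qpoch_Suc mult_ac)
    also have "\<dots> = qpoch t Q N * ((1 - s * Q ^ N) * h N)"
      unfolding Suc by (simp add: mult_ac)
    also have "\<dots> = qpoch t Q (Suc N) * h (Suc N)"
      unfolding step by (simp add: qpoch_Suc mult_ac)
    finally show ?case .
  qed simp
  moreover have "(\<lambda>N. qpoch s Q N * h 0) \<longlonglongrightarrow> qpoch_inf s Q * h 0"
    by (intro tendsto_intros qpoch_LIMSEQ Q)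
  moreover have "(\<lambda>N. qpoch t Q N * h N) \<longlonglongrightarrow> qpoch_inf t Q * 1"
    unfolding h_def by (intro tendsto_mult qpoch_LIMSEQ suminf_qbinom_term_LIMSEQ assms)
  ultimately have "qpoch_inf s Q * h 0 = qpoch_inf t Q"
    using LIMSEQ_unique by fastforce
  hence "h 0 = qpoch_inf t Q / qpoch_inf s Q"
    using qpoch_inf_nonzero[OF assms] by (simp add: field_simps)
  moreover have "qbinom_term Q s t sums h 0"
    using summable_norm_cancel[OF summable_norm_qbinom_term[OF assms]]
    by (simp add: h_def summable_sums)
  ultimately show ?thesis by simp
qed

section \<open>The double series A(u) and its product formula\<close>

definition conv_term :: "'a::field \<Rightarrow> nat \<Rightarrow> nat \<Rightarrow> 'a" where
  "conv_term x a b = x ^ nat ((int a - int b)\<^sup>2) / (qpoch (x\<^sup>2) (x\<^sup>2) a * qpoch (x\<^sup>2) (x\<^sup>2) b)"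

definition conv_sum :: "'a::field \<Rightarrow> nat \<Rightarrow> 'a" where
  "conv_sum x n = (\<Sum>a\<le>n. conv_term x a (n - a))"

text \<open>Since |x|^((a-b)^2) \<le> 1 and the reciprocal symbols are bounded by C, a product of
  two geometric series in |u| is a majorant. Absolute summability later permits summing by rows and
  regrouping by diagonals.\<close>

lemma abs_summable_conv_term:
  fixes x u :: complex
  assumes x: "norm x < 1" and u: "norm u < 1"
  shows "(\<lambda>(a, b). norm (conv_term x a b * u ^ (a + b))) summable_on UNIV"
proof -
  have "norm (x\<^sup>2) < 1" using x by (simp add: norm_power power_less_one_iff)
  from inverse_qpoch_bounded[OF this this] obtain C where
    C: "\<And>n. norm (1 / qpoch (x\<^sup>2) (x\<^sup>2) n) \<le> C" by blast
  have C0: "0 \<le> C" using norm_ge_zero C order_trans by blast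
  have geo: "(\<lambda>n. norm u ^ n) summable_on UNIV"
    using u by (intro norm_summable_imp_summable_on) (simp add: norm_power summable_geometric)
  have "(\<lambda>(a, b). C * norm u ^ a * (C * norm u ^ b)) summable_on UNIV \<times> UNIV"
  proof (rule summable_on_SigmaI)
    fix a :: nat
    have "((\<lambda>b. norm u ^ b) has_sum (\<Sum>\<^sub>\<infinity>b. norm u ^ b)) UNIV"
      using geo by (rule has_sum_infsum)
    from has_sum_cmult_right[OF this, of "C * norm u ^ a * C"]
    show "((\<lambda>b. case (a, b) of (a, b) \<Rightarrow> C * norm u ^ a * (C * norm u ^ b))
        has_sum (norm u ^ a * (C * C * (\<Sum>\<^sub>\<infinity>b. norm u ^ b)))) UNIV"
      by (simp add: mult_ac)
  next
    show "(\<lambda>a. norm u ^ a * (C * C * (\<Sum>\<^sub>\<infinity>b. norm u ^ b))) summable_on UNIV"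
      using geo by (rule summable_on_cmult_left)
  qed (use C0 in auto)
  hence maj: "(\<lambda>(a, b). C * norm u ^ a * (C * norm u ^ b)) summable_on UNIV" by simp
  have bound: "norm (conv_term x a b * u ^ (a + b)) \<le> C * norm u ^ a * (C * norm u ^ b)" for a b
  proof -
    have "norm x ^ nat ((int a - int b)\<^sup>2) \<le> 1" using x by (intro power_le_one) auto
    moreover have "norm (1 / qpoch (x\<^sup>2) (x\<^sup>2) a) * norm (1 / qpoch (x\<^sup>2) (x\<^sup>2) b) \<le> C * C"
      by (intro mult_mono C C0 norm_ge_zero)
    ultimately have "norm x ^ nat ((int a - int b)\<^sup>2) *
        (norm (1 / qpoch (x\<^sup>2) (x\<^sup>2) a) * norm (1 / qpoch (x\<^sup>2) (x\<^sup>2) b)) \<le> 1 * (C * C)"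
      by (rule mult_mono) auto
    hence "norm (conv_term x a b) \<le> C * C"
      by (simp add: conv_term_def norm_mult norm_divide norm_power)
    from mult_right_mono[OF this, of "norm u ^ (a + b)"] show ?thesis
      by (simp add: norm_mult norm_power power_add mult_ac)
  qed
  show ?thesis
    using Infinite_Sum.abs_summable_on_comparison_test'[OF maj, of "\<lambda>(a, b). conv_term x a b * u ^ (a + b)"] bound
    by (simp add: case_prod_unfold)
qed

lemma prod_odd_powers: "(\<Prod>j<a. x ^ (2 * j + 1)) = (x::'a::comm_semiring_1) ^ (a\<^sup>2)"
proof (induction a)
  case (Suc a)
  have "(Suc a)\<^sup>2 = a\<^sup>2 + (2 * a + 1)" by (simp add: power2_eq_square)
  thus ?case using Suc by (simp add: power_add mult_ac)
qed simp

text \<open>Expanding the square additively avoids truncated subtraction when it is used to compare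
  exponents.\<close>

lemma nat_diff_squared: "nat ((int a - int b)\<^sup>2) + 2 * a * b = a\<^sup>2 + b\<^sup>2"
proof -
  have "int (nat ((int a - int b)\<^sup>2)) = (int a - int b)\<^sup>2" by (rule nat_0_le) simp
  also have "\<dots> = int (a\<^sup>2 + b\<^sup>2) - int (2 * a * b)"
    by (simp add: power2_eq_square algebra_simps)
  finally show ?thesis by linarith
qed

text \<open>By (a-b)^2 = a^2 + b^2 - 2ab, the row is a constant times Euler's series at
  \<open>?w\<close>. The first \<open>a\<close> factors of the resulting infinite product split off
  and combine with u^a x^(a^2) into the numerator of a q-binomial term; the remaining product is
  independent of \<open>a\<close>.\<close>

lemma conv_term_row_sums:
  fixes x u :: complex
  assumes x: "norm x < 1" and x0: "x \<noteq> 0"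
  shows "(\<lambda>b. conv_term x a b * u ^ (a + b)) sums
           (qbinom_term (x\<^sup>2) (u\<^sup>2) (- (u * x)) a * qpoch_inf (- (u * x)) (x\<^sup>2))"
proof -
  let ?Q = "x\<^sup>2"
  let ?w = "- (u * x / x ^ (2 * a))"
  have Q: "norm ?Q < 1" using x by (simp add: norm_power power_less_one_iff)
  \<comment> \<open>Going from \<open>a\<close> to \<open>Suc a\<close> adds the leading factor 1 +
    u / x^(2a+1). The new power x^(2a+1), from (a+1)^2 - a^2, clears its denominator and leaves u +
    x^(2a+1).\<close>
  have shift: "x ^ (a\<^sup>2) * qpoch_inf (- (u * x / x ^ (2 * a))) ?Q
               = (\<Prod>j<a. u + x ^ (2 * j + 1)) * qpoch_inf (- (u * x)) ?Q" for a
  proof (induction a)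
    case (Suc a)
    have sq: "(Suc a)\<^sup>2 = a\<^sup>2 + (2 * a + 1)" by (simp add: power2_eq_square)
    have "- (u * x / x ^ (2 * Suc a)) * ?Q = - (u * x / x ^ (2 * a))"
      using x0 by (simp add: field_simps power2_eq_square)
    hence "x ^ ((Suc a)\<^sup>2) * qpoch_inf (- (u * x / x ^ (2 * Suc a))) ?Q =
        x ^ (2 * a + 1) * (1 + u * x / x ^ (2 * Suc a)) *
          (x ^ (a\<^sup>2) * qpoch_inf (- (u * x / x ^ (2 * a))) ?Q)"
      by (subst qpoch_inf_Suc[OF Q]) (simp add: sq power_add)
    also have "x ^ (2 * a + 1) * (1 + u * x / x ^ (2 * Suc a)) = u + x ^ (2 * a + 1)"
      using x0 by (simp add: field_simps)
    finally show ?case unfolding Suc by simp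
  qed simp
  have q0: "qbinom_term ?Q 0 ?w b = x ^ (b\<^sup>2) * (u / x ^ (2 * a)) ^ b / qpoch ?Q ?Q b" for b
  proof -
    have "(\<Prod>j<b. 0 - ?w * ?Q ^ j) = (\<Prod>j<b. (u / x ^ (2 * a)) * x ^ (2 * j + 1))"
      by (intro prod.cong) (auto simp: power_mult)
    also have "\<dots> = (u / x ^ (2 * a)) ^ b * x ^ (b\<^sup>2)"
      unfolding prod.distrib prod_odd_powers by simp
    finally show ?thesis by (simp add: qbinom_term_def mult_ac)
  qed
  have sqdiff: "x ^ nat ((int a - int b)\<^sup>2) = x ^ (a\<^sup>2) * x ^ (b\<^sup>2) / (x ^ (2 * a)) ^ b" for b
  proof -
    have "x ^ nat ((int a - int b)\<^sup>2) * (x ^ (2 * a)) ^ b = x ^ (a\<^sup>2) * x ^ (b\<^sup>2)"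
      by (simp only: nat_diff_squared flip: power_add power_mult)
    thus ?thesis using x0 by (simp add: eq_divide_eq)
  qed
  \<comment> \<open>Euler's case s = 0. It is essential that t is unrestricted, since
    |\<open>?w\<close>| can be arbitrarily large as \<open>a\<close> grows.\<close>
  have "qbinom_term ?Q 0 ?w sums (qpoch_inf ?w ?Q / qpoch_inf 0 ?Q)"
    by (rule qbinomial_theorem[OF Q]) simp
  hence "qbinom_term ?Q 0 ?w sums qpoch_inf ?w ?Q" by (simp add: qpoch_inf_def)
  hence "(\<lambda>b. (u ^ a * x ^ (a\<^sup>2) / qpoch ?Q ?Q a) * qbinom_term ?Q 0 ?w b) sums
         ((u ^ a * x ^ (a\<^sup>2) / qpoch ?Q ?Q a) * qpoch_inf ?w ?Q)"
    by (rule sums_mult)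
  moreover have "(u ^ a * x ^ (a\<^sup>2) / qpoch ?Q ?Q a) * qbinom_term ?Q 0 ?w b
                 = conv_term x a b * u ^ (a + b)" for b
    unfolding q0 conv_term_def sqdiff by (simp add: power_add power_divide mult_ac)
  moreover have "(u ^ a * x ^ (a\<^sup>2) / qpoch ?Q ?Q a) * qpoch_inf ?w ?Q
                 = qbinom_term ?Q (u\<^sup>2) (- (u * x)) a * qpoch_inf (- (u * x)) ?Q"
  proof -
    have "(\<Prod>j<a. u\<^sup>2 - - (u * x) * ?Q ^ j) = (\<Prod>j<a. u * (u + x ^ (2 * j + 1)))"
      by (intro prod.cong) (auto simp: power_mult power2_eq_square algebra_simps)
    also have "\<dots> = u ^ a * (\<Prod>j<a. u + x ^ (2 * j + 1))"
      by (simp add: prod.distrib)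
    finally show ?thesis using shift[of a]
      by (simp add: qbinom_term_def mult.assoc)
  qed
  ultimately show ?thesis by simp
qed

theorem conv_sum_sums:
  fixes x u :: complex
  assumes x: "norm x < 1" and x0: "x \<noteq> 0" and u: "norm u < 1"
  shows "(\<lambda>n. conv_sum x n * u ^ n) sums
           ((qpoch_inf (- (u * x)) (x\<^sup>2))\<^sup>2 / qpoch_inf (u\<^sup>2) (x\<^sup>2))"
    (is "_ sums ?S")
proof -
  let ?f = "\<lambda>(a, b). conv_term x a b * u ^ (a + b)"
  let ?E = "qpoch_inf (- (u * x)) (x\<^sup>2)"
  let ?g = "\<lambda>a. qbinom_term (x\<^sup>2) (u\<^sup>2) (- (u * x)) a * ?E"
  have Q: "norm (x\<^sup>2) < 1" and u2: "norm (u\<^sup>2) < 1"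
    using x u by (simp_all add: norm_power power_less_one_iff)
  have "(\<lambda>z. norm (?f z)) summable_on UNIV \<times> UNIV"
    using abs_summable_conv_term[OF x u] by (simp add: case_prod_unfold)
  hence f: "?f summable_on UNIV \<times> UNIV" by (rule abs_summable_summable)
  have row: "((\<lambda>b. ?f (a, b)) has_sum ?g a) UNIV" for a
  proof -
    have "(\<lambda>b. conv_term x a b * u ^ (a + b)) summable_on UNIV"
      using f by (rule summable_on_SigmaD1) simp
    then obtain S where S: "((\<lambda>b. ?f (a, b)) has_sum S) UNIV"
      by (auto simp: summable_on_def)
    \<comment> \<open>The unordered sum of a row exists by absolute summability; uniqueness of
      limits identifies it with the ordered sum already computed.\<close>
    with conv_term_row_sums[OF x x0, of a u] has_sum_imp_sums[OF S] show ?thesis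
      using sums_unique2 by fastforce
  qed
  have col: "(?g has_sum ?S) UNIV"
  proof (rule norm_summable_imp_has_sum)
    show "summable (\<lambda>a. norm (?g a))"
      unfolding norm_mult by (intro summable_mult2 summable_norm_qbinom_term Q u2)
    show "?g sums ?S"
      using sums_mult2[OF qbinomial_theorem[OF Q u2, of "- (u * x)"], of ?E]
      by (simp add: power2_eq_square)
  qed
  have "(?f has_sum ?S) (UNIV \<times> UNIV)"
    by (rule has_sum_SigmaI[OF row col f])
  \<comment> \<open>Regroup the pairs (a, b) along the diagonals n = a + b.\<close>
  also have "?this \<longleftrightarrow> ((\<lambda>(n, a). conv_term x a (n - a) * u ^ n) has_sum ?S) (Sigma UNIV (\<lambda>n. {..n}))"
    by (rule has_sum_reindex_bij_witness[of _ "\<lambda>(n, a). (a, n - a)" "\<lambda>(a, b). (a + b, a)"]) auto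
  finally have "((\<lambda>n. \<Sum>a\<le>n. conv_term x a (n - a) * u ^ n) has_sum ?S) UNIV"
    by (rule has_sum_SigmaD) (auto intro: has_sum_finite)
  from has_sum_imp_sums[OF this] show ?thesis
    by (simp add: conv_sum_def sum_distrib_right)
qed

section \<open>Group orders in terms of q-Pochhammer symbols\<close>

lemma prod_power_minus_1:
  fixes q :: real
  assumes "q > 0"
  shows "(\<Prod>i=1..m. q ^ (2 * i) - 1) = q ^ (m\<^sup>2 + m) * qpoch ((1 / q)\<^sup>2) ((1 / q)\<^sup>2) m"
proof (induction m)
  case (Suc m)
  \<comment> \<open>The exponent m^2 + m = 2 + 4 + ... + 2m collects the powers q^(2i) extracted
    from the factors; this is its increment.\<close>
  have sq: "(Suc m)\<^sup>2 + Suc m = (m\<^sup>2 + m) + 2 * Suc m" by (simp add: power2_eq_square)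
  have "q ^ (2 * Suc m) - 1 = q ^ (2 * Suc m) * (1 - (1 / q)\<^sup>2 * ((1 / q)\<^sup>2) ^ m)"
    using assms by (simp add: field_simps power_mult power2_eq_square power_mult_distrib)
  hence "(\<Prod>i=1..Suc m. q ^ (2 * i) - 1) = q ^ (m\<^sup>2 + m) * qpoch ((1 / q)\<^sup>2) ((1 / q)\<^sup>2) m *
           (q ^ (2 * Suc m) * (1 - (1 / q)\<^sup>2 * ((1 / q)\<^sup>2) ^ m))"
    using Suc by simp
  thus ?case
    unfolding sq power_add[of q "m\<^sup>2 + m"] qpoch_Suc by (simp only: mult_ac)
qed simp

lemma inverse_card_O_plus_even:
  assumes "q > 1"
  shows "1 / card_O_plus (2 * m) q
         = (q ^ m + 1) / (2 * q ^ (2 * m\<^sup>2) * qpoch ((1 / q)\<^sup>2) ((1 / q)\<^sup>2) m)"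
proof -
  have "m\<^sup>2 - m + (m\<^sup>2 + m) = 2 * m\<^sup>2" by (cases m) (auto simp: power2_eq_square)
  hence "q ^ (m\<^sup>2 - m) * q ^ (m\<^sup>2 + m) = q ^ (2 * m\<^sup>2)" by (metis power_add)
  thus ?thesis using prod_power_minus_1[of q m] assms
    by (auto simp: card_O_plus_def Let_def mult.assoc)
qed

text \<open>The case m = 0 fits the general formula: the left side is 1 / 0 = 0, and on the right
  q^0 - 1 = 0. Dimension 0 thus needs no separate treatment in the sums over r.\<close>

lemma inverse_card_O_minus_even:
  assumes "q > 1"
  shows "1 / card_O_minus (2 * m) q
         = (q ^ m - 1) / (2 * q ^ (2 * m\<^sup>2) * qpoch ((1 / q)\<^sup>2) ((1 / q)\<^sup>2) m)"
proof -
  have "m\<^sup>2 - m + (m\<^sup>2 + m) = 2 * m\<^sup>2" by (cases m) (auto simp: power2_eq_square)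
  hence "q ^ (m\<^sup>2 - m) * q ^ (m\<^sup>2 + m) = q ^ (2 * m\<^sup>2)" by (metis power_add)
  thus ?thesis using prod_power_minus_1[of q m] assms
    by (auto simp: card_O_minus_def Let_def mult.assoc)
qed

lemma inverse_card_O_odd:
  assumes "q > 1"
  shows "1 / card_O_plus (2 * m + 1) q
           = 1 / (2 * q ^ (2 * m\<^sup>2 + m) * qpoch ((1 / q)\<^sup>2) ((1 / q)\<^sup>2) m)"
    and "1 / card_O_minus (2 * m + 1) q
           = 1 / (2 * q ^ (2 * m\<^sup>2 + m) * qpoch ((1 / q)\<^sup>2) ((1 / q)\<^sup>2) m)"
proof -
  have "m\<^sup>2 + (m\<^sup>2 + m) = 2 * m\<^sup>2 + m" by simp
  hence "q ^ (m\<^sup>2) * q ^ (m\<^sup>2 + m) = q ^ (2 * m\<^sup>2 + m)" by (metis power_add)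
  thus "1 / card_O_plus (2 * m + 1) q
           = 1 / (2 * q ^ (2 * m\<^sup>2 + m) * qpoch ((1 / q)\<^sup>2) ((1 / q)\<^sup>2) m)"
    and "1 / card_O_minus (2 * m + 1) q
           = 1 / (2 * q ^ (2 * m\<^sup>2 + m) * qpoch ((1 / q)\<^sup>2) ((1 / q)\<^sup>2) m)"
    using prod_power_minus_1[of q m] assms
    by (auto simp: card_O_plus_def card_O_minus_def Let_def mult.assoc)
qed

text \<open>The identity (a-b)^2 + (a+b)^2 = 2a^2 + 2b^2 rewrites the coefficient with the powers
  q^(2a^2), q^(2b^2) of the group orders. The numerator is the weight q^(n^2) for n = a + b.\<close>

lemma conv_term_inverse:
  fixes q :: real
  assumes "q > 0"
  shows "conv_term (1 / q) a b = q ^ ((a + b)\<^sup>2) / (q ^ (2 * a\<^sup>2) * q ^ (2 * b\<^sup>2) *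
           (qpoch ((1 / q)\<^sup>2) ((1 / q)\<^sup>2) a * qpoch ((1 / q)\<^sup>2) ((1 / q)\<^sup>2) b))"
proof -
  have "nat ((int a - int b)\<^sup>2) + (a + b)\<^sup>2 = 2 * a\<^sup>2 + 2 * b\<^sup>2"
    using nat_diff_squared[of a b] by (simp add: power2_sum)
  hence "q ^ nat ((int a - int b)\<^sup>2) * q ^ ((a + b)\<^sup>2) = q ^ (2 * a\<^sup>2) * q ^ (2 * b\<^sup>2)"
    by (metis power_add)
  hence "(1 / q) ^ nat ((int a - int b)\<^sup>2) = q ^ ((a + b)\<^sup>2) / (q ^ (2 * a\<^sup>2) * q ^ (2 * b\<^sup>2))"
    using assms by (simp add: field_simps)
  thus ?thesis by (simp add: conv_term_def)
qed

section \<open>The inner sum over r, split by parity\<close>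

lemma sum_even_odd_split:
  fixes f :: "nat \<Rightarrow> 'a::comm_monoid_add"
  shows "(\<Sum>r\<le>2 * n. f r) = (\<Sum>a\<le>n. f (2 * a)) + (\<Sum>a<n. f (2 * a + 1))"
  by (induction n) (simp_all add: ac_simps)

lemma orthogonal_sum_eq:
  fixes q :: real
  assumes q: "q > 1"
  shows "q ^ (n\<^sup>2) * (\<Sum>r\<le>2 * n. 1 / (card_O_plus r q * card_O_minus (2 * n - r) q))
         = ((q ^ n - 1) * conv_sum (1 / q) n
            + (if n = 0 then 0 else q ^ n * conv_sum (1 / q) (n - 1))) / 4"
proof -
  let ?p = "qpoch ((1 / q)\<^sup>2) ((1 / q)\<^sup>2)"
  let ?f = "\<lambda>r. 1 / (card_O_plus r q * card_O_minus (2 * n - r) q)"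
  let ?c = "conv_term (1 / q)"
  have even: "q ^ (n\<^sup>2) * ?f (2 * a) = (q ^ a + 1) * (q ^ (n - a) - 1) * ?c a (n - a) / 4"
    if "a \<le> n" for a
  proof -
    have "?f (2 * a) = (1 / card_O_plus (2 * a) q) * (1 / card_O_minus (2 * (n - a)) q)"
      by (simp add: right_diff_distrib')
    thus ?thesis
      unfolding inverse_card_O_plus_even[OF q] inverse_card_O_minus_even[OF q]
      using conv_term_inverse[of q a "n - a"] q that by (simp add: mult_ac)
  qed
  have odd: "q ^ (n\<^sup>2) * ?f (2 * a + 1) = q ^ n * ?c a (n - 1 - a) / 4"
    if less: "a < n" for a
  proof -
    obtain b where n: "n = Suc (a + b)" using less_imp_Suc_add[OF less] by blast
    have f: "?f (2 * a + 1) = (1 / card_O_plus (2 * a + 1) q) * (1 / card_O_minus (2 * b + 1) q)"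
      by (simp add: n)
    \<comment> \<open>For odd r the indices satisfy a + b = n - 1. The extra powers q^a and q^b
      cancel those in the odd orders, leaving the factor q^n.\<close>
    have "n\<^sup>2 = (a + b)\<^sup>2 + a + b + n" by (simp add: n power2_eq_square)
    hence "q ^ (n\<^sup>2) = q ^ ((a + b)\<^sup>2) * q ^ a * q ^ b * q ^ n" by (simp only: power_add)
    moreover have "n - 1 - a = b" by (simp add: n)
    ultimately show ?thesis
      unfolding f inverse_card_O_odd[OF q] power_add[of q "2 * a\<^sup>2"] power_add[of q "2 * b\<^sup>2"]
      using conv_term_inverse[of q a b] q by (simp add: mult_ac)
  qed
  \<comment> \<open>With b = n - a, the even terms carry (q^a + 1)(q^b - 1) = q^n - 1 + q^b - q^a.
    As \<open>conv_term\<close> is symmetric, reversing the sum shows that the contributions of q^b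
    and q^a cancel.\<close>
  have sym: "(\<Sum>a\<le>n. q ^ a * ?c a (n - a)) = (\<Sum>a\<le>n. q ^ (n - a) * ?c a (n - a))"
    by (rule sum.reindex_bij_witness[of _ "\<lambda>a. n - a" "\<lambda>a. n - a"])
      (auto simp: conv_term_def mult_ac power2_commute)
  have "(\<Sum>a\<le>n. q ^ (n\<^sup>2) * ?f (2 * a))
        = (\<Sum>a\<le>n. (q ^ a + 1) * (q ^ (n - a) - 1) * ?c a (n - a) / 4)"
    using even by (intro sum.cong) auto
  also have "\<dots> = (\<Sum>a\<le>n. ((q ^ n - 1) * ?c a (n - a) + q ^ (n - a) * ?c a (n - a) - q ^ a * ?c a (n - a)) / 4)"
  proof (intro sum.cong refl)
    fix a assume "a \<in> {..n}"
    hence "q ^ a * q ^ (n - a) = q ^ n" by (simp flip: power_add)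
    hence "(q ^ a + 1) * (q ^ (n - a) - 1) = q ^ n - 1 + q ^ (n - a) - q ^ a"
      by (simp add: algebra_simps)
    thus "(q ^ a + 1) * (q ^ (n - a) - 1) * ?c a (n - a) / 4
        = ((q ^ n - 1) * ?c a (n - a) + q ^ (n - a) * ?c a (n - a) - q ^ a * ?c a (n - a)) / 4"
      by (simp only: distrib_right left_diff_distrib)
  qed
  also have "\<dots> = (q ^ n - 1) * conv_sum (1 / q) n / 4"
    unfolding sum_divide_distrib[symmetric] sum.distrib sum_subtractf sym
    by (simp add: conv_sum_def sum_distrib_left)
  finally have E: "(\<Sum>a\<le>n. q ^ (n\<^sup>2) * ?f (2 * a)) = (q ^ n - 1) * conv_sum (1 / q) n / 4" .
  have "(\<Sum>a<n. q ^ (n\<^sup>2) * ?f (2 * a + 1)) = (\<Sum>a<n. q ^ n * ?c a (n - 1 - a) / 4)"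
    using odd by (intro sum.cong) auto
  also have "\<dots> = (if n = 0 then 0 else q ^ n * conv_sum (1 / q) (n - 1)) / 4"
    by (cases n) (simp_all add: conv_sum_def sum_distrib_left sum_divide_distrib lessThan_Suc_atMost)
  finally have O: "(\<Sum>a<n. q ^ (n\<^sup>2) * ?f (2 * a + 1))
                   = (if n = 0 then 0 else q ^ n * conv_sum (1 / q) (n - 1)) / 4" .
  have "q ^ (n\<^sup>2) * (\<Sum>r\<le>2 * n. ?f r)
        = (\<Sum>a\<le>n. q ^ (n\<^sup>2) * ?f (2 * a)) + (\<Sum>a<n. q ^ (n\<^sup>2) * ?f (2 * a + 1))"
    unfolding sum_even_odd_split sum_distrib_left distrib_left ..
  thus ?thesis unfolding E O by (simp add: add_divide_distrib)
qed

section \<open>Summation over n and the closed form\<close>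

theorem theorem2p12:
  fixes q :: real and u :: complex
  assumes "q > 1" and "norm u < 1 / q"
  shows
    "(\<lambda>n. u ^ n * complex_of_real (q ^ (n\<^sup>2) *
        ((\<Sum>r=0..<2 * n. 1 / (card_O_plus r q * card_O_minus (2 * n - r) q)) +
         (\<Sum>r=1..2 * n. 1 / (card_O_minus r q * card_O_plus (2 * n - r) q)))))
     sums
      (1 / (2 * (1 - u * of_real q)) *
         ((\<Prod>i. (1 + u / of_real q ^ (2 * i))\<^sup>2) / (\<Prod>i. 1 - u\<^sup>2 / of_real q ^ (2 * i)))
       - 1 / 2 *
         ((\<Prod>i. (1 + u / of_real q ^ (2 * i + 1))\<^sup>2) / (\<Prod>i. 1 - u\<^sup>2 / of_real q ^ (2 * i))))"
proof -
  define Q x :: complex where "Q = of_real q" and "x = 1 / Q"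
  have Q0: "Q \<noteq> 0" and x0: "x \<noteq> 0" and x: "norm x < 1" and xQ: "x * Q = 1"
    using assms by (auto simp: Q_def x_def norm_divide)
  have x2: "norm (x\<^sup>2) < 1" using x by (simp add: norm_power power_less_one_iff)
  have uQ: "norm (u * Q) < 1" using assms by (simp add: Q_def norm_mult field_simps)
  have "1 / q < 1" using assms by simp
  with assms have u: "norm u < 1" by linarith
  have uQ1: "u * Q \<noteq> 1" "u * Q \<noteq> - 1" using uQ by auto
  let ?c = "conv_sum x"
  define D where "D = qpoch_inf (u\<^sup>2) (x\<^sup>2)"
  define A where "A = (qpoch_inf (- (u * x)) (x\<^sup>2))\<^sup>2 / D"
  \<comment> \<open>This is A(u q): since x = 1/q, the numerator argument u q x is u, and the
    denominator product starting at u^2 q^2 has one more factor, 1 - (u q)^2, than \<open>D\<close>.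
    The hypothesis |u| < 1/q is what makes u q an admissible argument.\<close>
  define B where "B = (qpoch_inf (- u) (x\<^sup>2))\<^sup>2 / ((1 - (u * Q)\<^sup>2) * D)"
  have A: "(\<lambda>n. ?c n * u ^ n) sums A"
    unfolding A_def D_def by (rule conv_sum_sums[OF x x0 u])
  have B: "(\<lambda>n. ?c n * (u * Q) ^ n) sums B"
  proof -
    have "u * Q * x = u" "(u * Q)\<^sup>2 * x\<^sup>2 = u\<^sup>2"
      using Q0 by (simp_all add: x_def power_divide power_mult_distrib)
    with conv_sum_sums[OF x x0 uQ] show ?thesis
      using qpoch_inf_Suc[OF x2, of "(u * Q)\<^sup>2"] by (simp add: B_def D_def)
  qed
  have "(\<lambda>n. (u * Q) * (?c n * (u * Q) ^ n)) sums ((u * Q) * B)"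
    by (rule sums_mult[OF B])
  \<comment> \<open>The vacuous test \<open>Suc n = 0\<close> gives the summand the form f (Suc n),
    so that \<open>sums_Suc_iff\<close> can prepend a zero term of index 0.\<close>
  hence "(\<lambda>n. if Suc n = 0 then 0 else ?c (Suc n - 1) * (u * Q) ^ Suc n) sums ((u * Q) * B)"
    by (simp add: mult_ac)
  hence B': "(\<lambda>n. if n = 0 then 0 else ?c (n - 1) * (u * Q) ^ n) sums ((u * Q) * B)"
    by (subst (asm) sums_Suc_iff) simp
  have total: "u ^ n * complex_of_real (q ^ (n\<^sup>2) *
        ((\<Sum>r=0..<2 * n. 1 / (card_O_plus r q * card_O_minus (2 * n - r) q)) +
         (\<Sum>r=1..2 * n. 1 / (card_O_minus r q * card_O_plus (2 * n - r) q))))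
       = (?c n * (u * Q) ^ n - ?c n * u ^ n + (if n = 0 then 0 else ?c (n - 1) * (u * Q) ^ n)) / 2"
    for n
  proof -
    let ?f = "\<lambda>r. 1 / (card_O_plus r q * card_O_minus (2 * n - r) q)"
    \<comment> \<open>The additional term r = 2n contains the minus type order in dimension 0 and
      vanishes because 1 / 0 = 0.\<close>
    have "(\<Sum>r=0..<2 * n. ?f r) = (\<Sum>r\<le>2 * n. ?f r)"
      by (intro sum.mono_neutral_left) (auto simp: card_O_minus_def)
    \<comment> \<open>The reflection of r to 2n - r turns the second sum into the first, so the
      bracket is twice the first sum.\<close>
    moreover have "(\<Sum>r=1..2 * n. 1 / (card_O_minus r q * card_O_plus (2 * n - r) q)) = (\<Sum>r=0..<2 * n. ?f r)"
      by (rule sum.reindex_bij_witness[of _ "\<lambda>r. 2 * n - r" "\<lambda>r. 2 * n - r"]) (auto simp: mult_ac)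
    ultimately have "q ^ (n\<^sup>2) * ((\<Sum>r=0..<2 * n. ?f r) +
         (\<Sum>r=1..2 * n. 1 / (card_O_minus r q * card_O_plus (2 * n - r) q)))
       = 2 * (q ^ (n\<^sup>2) * (\<Sum>r\<le>2 * n. ?f r))"
      by simp
    also have "\<dots> = ((q ^ n - 1) * conv_sum (1 / q) n
            + (if n = 0 then 0 else q ^ n * conv_sum (1 / q) (n - 1))) / 2"
      unfolding orthogonal_sum_eq[OF assms(1)] by simp
    finally have eq: "q ^ (n\<^sup>2) * ((\<Sum>r=0..<2 * n. ?f r) +
         (\<Sum>r=1..2 * n. 1 / (card_O_minus r q * card_O_plus (2 * n - r) q))) = \<dots>" .
    have c: "complex_of_real (conv_sum (1 / q) m) = ?c m" for m
      by (simp add: conv_sum_def conv_term_def qpoch_of_real x_def Q_def)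
    have ceq: "complex_of_real (((q ^ n - 1) * conv_sum (1 / q) n
            + (if n = 0 then 0 else q ^ n * conv_sum (1 / q) (n - 1))) / 2)
        = ((Q ^ n - 1) * ?c n + (if n = 0 then 0 else Q ^ n * ?c (n - 1))) / 2"
      by (simp add: c flip: Q_def)
    show ?thesis
      unfolding eq ceq by (cases "n = 0") (simp_all add: power_mult_distrib algebra_simps)
  qed
  \<comment> \<open>Taking v = u gives the product over even powers of 1/q, and v = u x the one over
    odd powers. Convergence of the product allows the square to be moved outside.\<close>
  have P: "(\<Prod>i. (1 + v / of_real q ^ (2 * i))\<^sup>2) = (qpoch_inf (- v) (x\<^sup>2))\<^sup>2" for v
  proof -
    have "v / of_real q ^ (2 * i) = v * (x\<^sup>2) ^ i" for i
      by (simp add: x_def Q_def power_divide power_mult)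
    thus ?thesis
      using prodinf_mult[OF convergent_prod_qpoch[OF x2, of "- v"] convergent_prod_qpoch[OF x2, of "- v"]]
      by (simp add: qpoch_inf_def power2_eq_square)
  qed
  have P1: "(\<Prod>i. (1 + u / of_real q ^ (2 * i + 1))\<^sup>2) = (qpoch_inf (- (u * x)) (x\<^sup>2))\<^sup>2"
    using P[of "u * x"] by (simp add: x_def Q_def mult_ac)
  have P2: "(\<Prod>i. 1 - u\<^sup>2 / of_real q ^ (2 * i)) = D"
    by (simp add: D_def qpoch_inf_def x_def Q_def power_divide power_mult)
  have "(\<lambda>n. (?c n * (u * Q) ^ n - ?c n * u ^ n + (if n = 0 then 0 else ?c (n - 1) * (u * Q) ^ n)) / 2)
        sums ((B - A + u * Q * B) / 2)"
    by (intro sums_divide sums_add sums_diff A B B')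
  \<comment> \<open>The factor 1 + u q multiplying \<open>B\<close> cancels against 1 - (u q)^2 = (1
    - u q)(1 + u q); it is nonzero because |u q| < 1.\<close>
  moreover have "(B - A + u * Q * B) / 2
      = 1 / (2 * (1 - u * Q)) * ((qpoch_inf (- u) (x\<^sup>2))\<^sup>2 / D) - 1 / 2 * A"
  proof -
    have "1 + u * Q \<noteq> 0" using uQ1 by (metis add_eq_0_iff)
    moreover have "1 - (u * Q)\<^sup>2 = (1 - u * Q) * (1 + u * Q)"
      by (simp add: power2_eq_square algebra_simps)
    ultimately have "(1 + u * Q) * B = (qpoch_inf (- u) (x\<^sup>2))\<^sup>2 / ((1 - u * Q) * D)"
      by (simp add: B_def)
    thus ?thesis by (simp add: field_simps)
  qed
  ultimately have "(\<lambda>n. (?c n * (u * Q) ^ n - ?c n * u ^ n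
          + (if n = 0 then 0 else ?c (n - 1) * (u * Q) ^ n)) / 2)
        sums (1 / (2 * (1 - u * Q)) * ((qpoch_inf (- u) (x\<^sup>2))\<^sup>2 / D) - 1 / 2 * A)"
    by (simp only:)
  thus ?thesis
    unfolding total P P1 P2 by (simp only: Q_def A_def)
qed

end
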